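(* Let $m,k\in\mathbb{N}$ with $k<2m$, and let $a>0$. For $n\ge 0$ let $r_{m,k}(n)=\#\{(x_1,\dots,x_k)\in\mathbb{Z}^k : x_1^{2m}+\cdots+x_k^{2m}=n\}$, and for $z>0$ let $U_{2m}(z)=\sum_{t\in\mathbb{Z}}\frac{1}{t^{2m}+z^{2m}}$. Then \[ \sum_{n=0}^{\infty}\frac{r_{m,k}(n)}{n+a}\;\ge\;\frac{1}{k}\,U_{2m}\!\left(\left(\tfrac{a}{k}\right)^{1/(2m)}\right). \]
   Context: $\mathbb{N}$ denotes the positive integers. $r_{m,k}(n)$ counts representations of $n$ as a sum of $k$ $(2m)$-th powers of integers (signs and order counted). $U_{2m}$ is called the generalized cotangent series. *)

theory Defs
  imports "HOL-Analysis.Analysis"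
begin

definition rep_tuples :: "nat \<Rightarrow> nat \<Rightarrow> nat \<Rightarrow> (nat \<Rightarrow> int) set" where
  "rep_tuples m k n = {x \<in> {1..k} \<rightarrow>\<^sub>E UNIV. (\<Sum>i=1..k. x i ^ (2 * m)) = int n}"

definition rep_count :: "nat \<Rightarrow> nat \<Rightarrow> nat \<Rightarrow> nat" where
  "rep_count m k n = card (rep_tuples m k n)"

text \<open>The argument \<open>d\<close> is the exponent, so the series \<open>U\<^bsub>2m\<^esub>\<close> is \<open>gen_cot (2 * m)\<close>.\<close>

definition gen_cot :: "nat \<Rightarrow> real \<Rightarrow> real" where
  "gen_cot d z = (\<Sum>\<^sub>\<infinity>t\<in>(UNIV :: int set). 1 / (real_of_int t ^ d + z ^ d))"

text \<open>The next two facts exclude the junk values of \<open>card\<close> (infinite set) and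
  \<open>infsum\<close> (divergent family).\<close>

lemma finite_rep_tuples:
  assumes "1 \<le> m"
  shows "finite (rep_tuples m k n)"
proof (rule finite_subset)
  show "finite ({1..k} \<rightarrow>\<^sub>E {- int n..int n})"
    by (intro finite_PiE) auto
  show "rep_tuples m k n \<subseteq> {1..k} \<rightarrow>\<^sub>E {- int n..int n}"
  proof
    fix x assume x: "x \<in> rep_tuples m k n"
    have "x i \<in> {- int n..int n}" if i: "i \<in> {1..k}" for i
    proof -
      have "x i ^ (2 * m) \<le> (\<Sum>i=1..k. x i ^ (2 * m))"
        by (rule member_le_sum[OF i]) auto
      also have "\<dots> = int n"
        using x by (simp add: rep_tuples_def)
      finally have le: "\<bar>x i\<bar> ^ (2 * m) \<le> int n"
        by (simp add: power_even_abs)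
      have "\<bar>x i\<bar> \<le> \<bar>x i\<bar> ^ (2 * m)"
        using assms by (cases "x i = 0") (auto intro!: self_le_power)
      with le show ?thesis by auto
    qed
    with x show "x \<in> {1..k} \<rightarrow>\<^sub>E {- int n..int n}"
      by (auto simp: rep_tuples_def PiE_iff)
  qed
qed

lemma gen_cot_summable_on:
  fixes z :: real
  assumes "1 \<le> m" and "z > 0"
  shows "(\<lambda>t::int. 1 / (real_of_int t ^ (2 * m) + z ^ (2 * m))) summable_on UNIV"
proof -
  let ?f = "\<lambda>t::int. 1 / (real_of_int t ^ (2 * m) + z ^ (2 * m))"
  have nn: "?f t \<ge> 0" for t
    using assms by (auto intro!: add_nonneg_nonneg)
  have "summable (\<lambda>n. ?f (int n))"
  proof (rule summable_comparison_test)
    show "summable (\<lambda>n. inverse (real n ^ 2))"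
      using inverse_power_summable[of 2, where 'a = real] by simp
    have "norm (?f (int n)) \<le> inverse (real n ^ 2)" if "n \<ge> 1" for n
    proof -
      have "real n ^ 2 \<le> real n ^ (2 * m)"
        using that assms by (intro power_increasing) auto
      then have "real n ^ 2 \<le> real n ^ (2 * m) + z ^ (2 * m)"
        using assms by (smt (verit) zero_le_power)
      then have "?f (int n) \<le> 1 / real n ^ 2"
        using that by (intro divide_left_mono mult_pos_pos) (auto intro: less_le_trans[rotated])
      then show ?thesis
        using nn[of "int n"] by (simp add: inverse_eq_divide)
    qed
    then show "\<exists>N. \<forall>n\<ge>N. norm (?f (int n)) \<le> inverse (real n ^ 2)"
      by blast
  qed
  then have nat: "(\<lambda>n. ?f (int n)) summable_on UNIV"
    using nn by (subst summable_on_UNIV_nonneg_real_iff) auto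
  have pos: "?f summable_on range int"
    using nat by (subst summable_on_reindex) (auto simp: o_def)
  have neg: "?f summable_on range (\<lambda>n. - int n)"
    using nat by (subst summable_on_reindex) (auto simp: o_def inj_on_def)
  have "(UNIV :: int set) = range int \<union> range (\<lambda>n. - int n)"
    by (auto simp: image_iff) (metis int_cases2)
  then show ?thesis
    using summable_on_union[OF pos neg] by simp
qed

end

theory Submission
  imports Defs
begin

text \<open>Regrouping by the value \<open>n\<close>, the left-hand side is the sum of
  \<open>1 / (x\<^sub>1\<^sup>2\<^sup>m + \<dots> + x\<^sub>k\<^sup>2\<^sup>m + a)\<close> over all integer tuples, and the right-hand side is the
  part of that sum coming from the constant tuples. Convergence: each \<open>(1 + \<bar>x\<^sub>i\<bar>)\<^sup>k\<^sup>+\<^sup>1\<close> is at most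
  a constant times the denominator since \<open>k + 1 \<le> 2m\<close>, so taking the geometric mean over \<open>i\<close>
  dominates the family by a product of convergent one-variable series
  \<open>\<Sum> (1 + \<bar>t\<bar>)\<close> to the power \<open>-(k + 1) / k\<close>.\<close>

text \<open>For real-valued families summability is absolute summability, so the product theorem for
  \<open>Infinite_Set_Sum.abs_summable_on\<close> carries over.\<close>

lemma summable_on_prod_PiE_real:
  fixes f :: "'a \<Rightarrow> 'b \<Rightarrow> real"
  assumes "finite A" and "\<And>i. i \<in> A \<Longrightarrow> countable (B i)"
    and "\<And>i. i \<in> A \<Longrightarrow> f i summable_on B i"
  shows "(\<lambda>g. \<Prod>i\<in>A. f i (g i)) summable_on PiE A B"
proof -
  have "Infinite_Set_Sum.abs_summable_on (f i) (B i)" if "i \<in> A" for i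
    using assms(3)[OF that]
    unfolding abs_summable_equivalent[symmetric] summable_on_iff_abs_summable_on_real[symmetric] .
  then have "Infinite_Set_Sum.abs_summable_on (\<lambda>g. \<Prod>i\<in>A. f i (g i)) (PiE A B)"
    using assms by (intro abs_summable_on_prod_PiE) auto
  then show ?thesis
    unfolding abs_summable_equivalent[symmetric] summable_on_iff_abs_summable_on_real[symmetric] .
qed

lemma summable_on_int_powr:
  fixes s :: real
  assumes "s < -1"
  shows "(\<lambda>t::int. (1 + \<bar>real_of_int t\<bar>) powr s) summable_on UNIV"
proof -
  let ?f = "\<lambda>t::int. (1 + \<bar>real_of_int t\<bar>) powr s"
  have "summable (\<lambda>n. real (Suc n) powr s)"
    using assms by (subst summable_Suc_iff) (simp add: summable_real_powr_iff)
  then have nat: "(\<lambda>n. ?f (int n)) summable_on UNIV"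
    by (subst summable_on_UNIV_nonneg_real_iff) auto
  have pos: "?f summable_on range int"
    using nat by (subst summable_on_reindex) (auto simp: o_def)
  have neg: "?f summable_on range (\<lambda>n. - int n)"
    using nat by (subst summable_on_reindex) (auto simp: o_def inj_on_def)
  \<comment> \<open>The two ranges share 0, which is harmless: only summability is claimed, not a
    value.\<close>
  have "(UNIV :: int set) = range int \<union> range (\<lambda>n. - int n)"
    by (auto simp: image_iff) (metis int_cases2)
  then show ?thesis
    using summable_on_union[OF pos neg] by simp
qed

text \<open>The constant covers two cases: \<open>1 / a\<close> handles t = 0, where the left side
  is 1, and \<open>2 ^ d\<close> handles the rest, where 1 + |t| \<le> 2|t|.\<close>

lemma one_plus_abs_power_le:
  fixes t :: int and a :: real
  assumes "a > 0" and "l \<le> d" and "even d"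
  shows "(1 + \<bar>real_of_int t\<bar>) ^ l \<le> (2 ^ d + 1 / a) * (real_of_int t ^ d + a)"
proof (cases "t = 0")
  case True
  have "1 \<le> (2 ^ d + 1 / a) * a"
    using assms by (simp add: distrib_right)
  also have "\<dots> \<le> (2 ^ d + 1 / a) * (real_of_int t ^ d + a)"
    using assms by (intro mult_left_mono) (auto simp: zero_le_even_power)
  finally show ?thesis using True by simp
next
  case False
  then have t: "1 \<le> \<bar>real_of_int t\<bar>" by linarith
  have "(1 + \<bar>real_of_int t\<bar>) ^ l \<le> (1 + \<bar>real_of_int t\<bar>) ^ d"
    using assms by (intro power_increasing) auto
  also have "\<dots> \<le> (2 * \<bar>real_of_int t\<bar>) ^ d"
    using t by (intro power_mono) auto
  also have "\<dots> = 2 ^ d * real_of_int t ^ d"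
    using assms by (simp add: power_mult_distrib power_even_abs)
  also have "\<dots> \<le> (2 ^ d + 1 / a) * (real_of_int t ^ d + a)"
    using assms by (intro mult_mono) (auto simp: zero_le_even_power)
  finally show ?thesis .
qed

lemma inverse_sum_powers_summable_on:
  fixes a :: real
  assumes "1 \<le> k" and "k < 2 * m" and "a > 0"
  shows "(\<lambda>x. 1 / ((\<Sum>i=1..k. real_of_int (x i) ^ (2 * m)) + a))
           summable_on ({1..k} \<rightarrow>\<^sub>E (UNIV :: int set))"
proof (rule summable_on_comparison_test)
  \<comment> \<open>s > 1 makes every one-variable series converge, while k * s = k + 1 \<le> 2m
    keeps the growth below that of the denominator.\<close>
  define s where "s = real (Suc k) / real k"
  define C where "C = 2 ^ (2 * m) + 1 / a"
  have "s > 1" using assms by (simp add: s_def)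
  then show "(\<lambda>x. C * (\<Prod>i=1..k. (1 + \<bar>real_of_int (x i)\<bar>) powr (- s)))
               summable_on ({1..k} \<rightarrow>\<^sub>E (UNIV :: int set))"
    by (intro summable_on_cmult_right summable_on_prod_PiE_real summable_on_int_powr) auto
  have C: "C > 0" using assms by (simp add: C_def add_pos_pos)
  fix x :: "nat \<Rightarrow> int"
  define S where "S = (\<Sum>i=1..k. real_of_int (x i) ^ (2 * m)) + a"
  have S: "S > 0"
    unfolding S_def using assms by (intro add_nonneg_pos sum_nonneg) auto
  then show "0 \<le> 1 / ((\<Sum>i=1..k. real_of_int (x i) ^ (2 * m)) + a)"
    unfolding S_def by simp
  \<comment> \<open>Each factor is bounded by the k-th root of \<open>C * S\<close>, so that the
    product of all k factors is at most \<open>C * S\<close> itself.\<close>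
  have le: "(1 + \<bar>real_of_int (x i)\<bar>) powr s \<le> (C * S) powr (1 / real k)" if i: "i \<in> {1..k}" for i
  proof -
    have "real_of_int (x i) ^ (2 * m) \<le> (\<Sum>i=1..k. real_of_int (x i) ^ (2 * m))"
      by (rule member_le_sum[OF i]) auto
    then have "C * (real_of_int (x i) ^ (2 * m) + a) \<le> C * S"
      using C by (simp add: S_def)
    then have "(1 + \<bar>real_of_int (x i)\<bar>) ^ Suc k \<le> C * S"
      using one_plus_abs_power_le[of a "Suc k" "2 * m" "x i"] assms by (simp add: C_def)
    then have "((1 + \<bar>real_of_int (x i)\<bar>) powr real (Suc k)) powr (1 / real k)
                 \<le> (C * S) powr (1 / real k)"
      by (intro powr_mono2) (auto simp: powr_realpow simp del: power_Suc of_nat_Suc)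
    then show ?thesis by (simp add: powr_powr s_def)
  qed
  have "(\<Prod>i=1..k. (1 + \<bar>real_of_int (x i)\<bar>) powr s) \<le> (\<Prod>i=1..k. (C * S) powr (1 / real k))"
    using le by (intro prod_mono) auto
  also have "\<dots> = C * S"
    using C S assms by (simp add: powr_realpow[symmetric] powr_powr)
  finally have "1 / S \<le> C * (1 / (\<Prod>i=1..k. (1 + \<bar>real_of_int (x i)\<bar>) powr s))"
    using S by (simp add: field_simps prod_pos)
  then show "1 / ((\<Sum>i=1..k. real_of_int (x i) ^ (2 * m)) + a)
          \<le> C * (\<Prod>i=1..k. (1 + \<bar>real_of_int (x i)\<bar>) powr (- s))"
    by (simp add: S_def powr_minus_divide prod_dividef)
qed

text \<open>The sets \<open>rep_tuples m k n\<close> partition all tuples by their power sum, and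
  the summand is constantly \<open>f n\<close> on each. Unconditional summability permits this
  regrouping.\<close>

lemma rep_count_sums:
  fixes f :: "nat \<Rightarrow> real"
  assumes "1 \<le> m"
    and "(\<lambda>x. f (nat (\<Sum>i=1..k. x i ^ (2 * m)))) summable_on ({1..k} \<rightarrow>\<^sub>E UNIV)"
  shows "(\<lambda>n. real (rep_count m k n) * f n) sums
           (\<Sum>\<^sub>\<infinity>x\<in>{1..k} \<rightarrow>\<^sub>E UNIV. f (nat (\<Sum>i=1..k. x i ^ (2 * m))))"
proof -
  define N where "N = (\<lambda>x :: nat \<Rightarrow> int. \<Sum>i=1..k. x i ^ (2 * m))"
  let ?S = "\<Sum>\<^sub>\<infinity>x\<in>{1..k} \<rightarrow>\<^sub>E UNIV. f (nat (N x))"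
  have nn: "N x \<ge> 0" for x
    unfolding N_def by (intro sum_nonneg) auto
  have rep: "rep_tuples m k n = {x \<in> {1..k} \<rightarrow>\<^sub>E UNIV. N x = int n}" for n
    by (simp add: rep_tuples_def N_def)
  have "((\<lambda>x. f (nat (N x))) has_sum ?S) ({1..k} \<rightarrow>\<^sub>E UNIV)"
    using assms(2) unfolding N_def by (rule has_sum_infsum)
  \<comment> \<open>Each tuple is tagged with its power sum; \<open>nat\<close> loses nothing
    because \<open>N x\<close> is nonnegative.\<close>
  also have "?this \<longleftrightarrow> ((\<lambda>(n, x). f n) has_sum ?S) (Sigma UNIV (rep_tuples m k))"
    by (rule has_sum_reindex_bij_witness[where i = snd and j = "\<lambda>x. (nat (N x), x)"])
       (clarsimp simp: rep nn)+
  \<comment> \<open>The inner sum runs over a finite set, so it equals the cardinality times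
    \<open>f n\<close>.\<close>
  finally have "((\<lambda>n. real (rep_count m k n) * f n) has_sum ?S) UNIV"
    by (rule has_sum_SigmaD)
       (use assms(1) in \<open>auto intro!: has_sum_finiteI finite_rep_tuples simp: rep_count_def\<close>)
  then show ?thesis unfolding N_def by (rule has_sum_imp_sums)
qed

theorem theorem2p1:
  fixes m k :: nat and a :: real
  assumes "1 \<le> m" and "1 \<le> k" and "k < 2 * m" and "a > 0"
  shows "summable (\<lambda>n. real (rep_count m k n) / (real n + a)) \<and>
         (\<Sum>n. real (rep_count m k n) / (real n + a))
           \<ge> 1 / real k * gen_cot (2 * m) ((a / real k) powr (1 / real (2 * m)))"
proof -
  let ?T = "{1..k} \<rightarrow>\<^sub>E (UNIV :: int set)"
  define g where "g = (\<lambda>x :: nat \<Rightarrow> int. 1 / ((\<Sum>i=1..k. real_of_int (x i) ^ (2 * m)) + a))"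
  define diag where "diag = (\<lambda>t :: int. \<lambda>i\<in>{1..k}. t)"
  have g_eq: "g = (\<lambda>x. 1 / (real (nat (\<Sum>i=1..k. x i ^ (2 * m))) + a))"
    by (auto simp: g_def fun_eq_iff sum_nonneg of_nat_nat)
  have g_nonneg: "0 \<le> g x" for x
    using assms by (auto simp: g_def intro!: add_nonneg_nonneg sum_nonneg)
  have summ: "g summable_on ?T"
    unfolding g_def using assms by (intro inverse_sum_powers_summable_on)
  have sums: "(\<lambda>n. real (rep_count m k n) / (real n + a)) sums infsum g ?T"
    using rep_count_sums[of m "\<lambda>n. 1 / (real n + a)" k] assms(1) summ by (simp add: g_eq)
  define z where "z = (a / real k) powr (1 / real (2 * m))"
  have z: "z ^ (2 * m) = a / real k"
    using assms by (simp add: z_def powr_realpow[symmetric] powr_powr)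
  \<comment> \<open>As k \<ge> 1, a coordinate exists from which t can be read off.\<close>
  have inj: "inj diag"
    using assms by (auto simp: diag_def inj_def fun_eq_iff split: if_splits)
  \<comment> \<open>On the diagonal the denominator is k t^(2m) + a = k (t^(2m) + a/k), which yields
    both the factor 1/k and the argument z.\<close>
  have g_diag: "g (diag t) = 1 / real k * (1 / (real_of_int t ^ (2 * m) + z ^ (2 * m)))" for t
    using assms by (simp add: g_def diag_def z distrib_left)
  have "1 / real k * gen_cot (2 * m) z = (\<Sum>\<^sub>\<infinity>t. g (diag t))"
    unfolding gen_cot_def g_diag by (rule infsum_cmult_right'[symmetric])
  also have "\<dots> = infsum g (range diag)"
    using infsum_reindex[OF inj, of g] by (simp add: o_def)
  also have "\<dots> \<le> infsum g ?T"
  \<comment> \<open>Discarding the tuples off the diagonal can only lower the sum, since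
    \<open>g\<close> is nonnegative.\<close>
  proof (rule infsum_mono_neutral)
    have sub: "range diag \<subseteq> ?T" by (auto simp: diag_def)
    then show "g summable_on range diag"
      using summ summable_on_subset_banach by blast
    show "g x \<le> 0" if "x \<in> range diag - ?T" for x
      using that sub by blast
  qed (use summ g_nonneg in auto)
  also have "\<dots> = (\<Sum>n. real (rep_count m k n) / (real n + a))"
    using sums by (rule sums_unique)
  finally show ?thesis
    using sums by (auto simp: z_def sums_iff)
qed

end
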